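(* Let $G$ be an infinite connected graph with maximum degree $\Delta$, where $3 \leq \Delta < \infty$. Then $D(G) \leq \Delta - 1$.
   Context: A distinguishing $k$-colouring of a graph $G=(V,E)$ is a map $c\colon V\to\{0,\dots,k-1\}$ such that the identity is the only automorphism $\gamma$ of $G$ with $c\circ\gamma=c$. The distinguishing number $D(G)$ is the least $k$ such that $G$ admits a distinguishing $k$-colouring. *)

theory Defs
  imports Main
begin

definition simple_graph :: "'a set \<Rightarrow> ('a \<Rightarrow> 'a \<Rightarrow> bool) \<Rightarrow> bool" where
  "simple_graph V E \<longleftrightarrow> (\<forall>u v. E u v \<longrightarrow> u \<in> V \<and> v \<in> V \<and> E v u \<and> u \<noteq> v)"

definition neighbours :: "'a set \<Rightarrow> ('a \<Rightarrow> 'a \<Rightarrow> bool) \<Rightarrow> 'a \<Rightarrow> 'a set" where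
  "neighbours V E v = {w \<in> V. E v w}"

definition degree :: "'a set \<Rightarrow> ('a \<Rightarrow> 'a \<Rightarrow> bool) \<Rightarrow> 'a \<Rightarrow> nat" where
  "degree V E v = card (neighbours V E v)"

definition max_degree :: "'a set \<Rightarrow> ('a \<Rightarrow> 'a \<Rightarrow> bool) \<Rightarrow> nat \<Rightarrow> bool" where
  "max_degree V E d \<longleftrightarrow>
     (\<forall>v\<in>V. finite (neighbours V E v) \<and> degree V E v \<le> d) \<and> (\<exists>v\<in>V. degree V E v = d)"

definition connected_graph :: "'a set \<Rightarrow> ('a \<Rightarrow> 'a \<Rightarrow> bool) \<Rightarrow> bool" where
  "connected_graph V E \<longleftrightarrow> (\<forall>u\<in>V. \<forall>v\<in>V. E\<^sup>*\<^sup>* u v)"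

definition automorphism :: "'a set \<Rightarrow> ('a \<Rightarrow> 'a \<Rightarrow> bool) \<Rightarrow> ('a \<Rightarrow> 'a) \<Rightarrow> bool" where
  "automorphism V E \<gamma> \<longleftrightarrow>
     bij_betw \<gamma> V V \<and> (\<forall>x\<in>V. \<forall>y\<in>V. E x y \<longleftrightarrow> E (\<gamma> x) (\<gamma> y))"

definition distinguishing_colouring ::
    "'a set \<Rightarrow> ('a \<Rightarrow> 'a \<Rightarrow> bool) \<Rightarrow> nat \<Rightarrow> ('a \<Rightarrow> nat) \<Rightarrow> bool" where
  "distinguishing_colouring V E k c \<longleftrightarrow>
     (\<forall>v\<in>V. c v < k) \<and>
     (\<forall>\<gamma>. automorphism V E \<gamma> \<and> (\<forall>v\<in>V. c (\<gamma> v) = c v) \<longrightarrow> (\<forall>v\<in>V. \<gamma> v = v))"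

definition distinguishing_number :: "'a set \<Rightarrow> ('a \<Rightarrow> 'a \<Rightarrow> bool) \<Rightarrow> nat" where
  "distinguishing_number V E = (LEAST k. \<exists>c. distinguishing_colouring V E k c)"

end

theory Submission
  imports Defs "HOL-Library.Countable_Set"
begin

text \<open>
Put k = \<Delta> - 1. By Koenig's lemma the graph has an induced ray. Call a neighbour of the starting
vertex of such a ray private if no later vertex of the ray is adjacent to it.

Suppose first that some induced ray v has fewer than k private neighbours. Colour v by 0 and its
neighbours by nonzero colours, so that the outer neighbours with the same last neighbour on v get
distinct colours; the slack at the start of v makes this possible. Then explore the graph from there,
at each step colouring injectively the new neighbours of one explored vertex, with 0 used only if
there are k of them. If the vertices to explore are chosen with some care, an induced ray of 0s
disjoint from v must follow the exploration tree away from v and start at a vertex with k private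
neighbours. Hence a colour preserving automorphism maps v to itself, fixes it pointwise, and then
fixes everything in the order of exploration.

Otherwise every neighbour other than v 1 of the start of an induced ray v can be prepended to v.
So every vertex starts a unique induced ray that shares a tail with a fixed ray R, and this turns the
graph into the (k + 1)-regular tree in which each vertex has a parent, namely the next vertex towards
the end of R, and k children. Give the k children of each vertex distinct colours, such that R
receives a sequence that is not eventually periodic. The image of R under a colour preserving
automorphism runs either eventually away from the end of R, and then the sequence would eventually
have period 2, or towards it, and then aperiodicity makes the automorphism fix a tail of R. It then
commutes with taking parents, and so it is trivial.
\<close>

section \<open>Graphs of degree at most \<open>k + 1\<close> and their induced rays\<close>

locale bounded_graph =
  fixes V :: "'a set" and E :: "'a \<Rightarrow> 'a \<Rightarrow> bool" and k :: nat
  assumes simple: "simple_graph V E"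
    and inf: "infinite V"
    and conn: "connected_graph V E"
    and fin_nb: "\<And>v. v \<in> V \<Longrightarrow> finite (neighbours V E v)"
    and card_nb: "\<And>v. v \<in> V \<Longrightarrow> card (neighbours V E v) \<le> Suc k"
    and k2: "2 \<le> k"
begin

abbreviation nb :: "'a \<Rightarrow> 'a set" where "nb \<equiv> neighbours V E"

lemma E_sym: "E x y \<Longrightarrow> E y x"
  and E_irrefl: "\<not> E x x"
  and E_V1: "E x y \<Longrightarrow> x \<in> V"
  and E_V2: "E x y \<Longrightarrow> y \<in> V"
  using simple unfolding simple_graph_def by blast+

lemma nb_iff [simp]: "y \<in> nb x \<longleftrightarrow> E x y"
  using E_V2 by (auto simp: neighbours_def)

lemma finite_nb [simp]: "finite (nb x)"
proof (cases "x \<in> V")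
  case False
  then have "nb x = {}" using E_V1 by (auto simp: neighbours_def)
  then show ?thesis by simp
qed (rule fin_nb)

lemma card_nb_le: "card (nb x) \<le> Suc k"
proof (cases "x \<in> V")
  case False
  then have "nb x = {}" using E_V1 by (auto simp: neighbours_def)
  then show ?thesis by simp
qed (rule card_nb)

lemma boundary_edge:
  assumes "A \<noteq> {}" "A \<subseteq> V" "A \<noteq> V"
  obtains p x where "p \<in> A" "E p x" "x \<notin> A"
proof -
  obtain a where a: "a \<in> A" using assms by blast
  obtain y where y: "y \<in> V" "y \<notin> A" using assms by blast
  have "E\<^sup>*\<^sup>* a y" using conn a y assms unfolding connected_graph_def by blast
  then have "y \<notin> A \<longrightarrow> (\<exists>p x. p \<in> A \<and> E p x \<and> x \<notin> A)"
    by (induction rule: rtranclp_induct) (use a in blast)+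
  then show thesis using y that by blast
qed

definition iray :: "(nat \<Rightarrow> 'a) \<Rightarrow> bool" where
  "iray v \<longleftrightarrow> inj v \<and> (\<forall>i j. E (v i) (v j) \<longleftrightarrow> j = Suc i \<or> i = Suc j)"

definition private_nb :: "(nat \<Rightarrow> 'a) \<Rightarrow> 'a set" where
  "private_nb v = {x. E (v 0) x \<and> (\<forall>j. \<not> E (v (Suc j)) x)}"

lemma iray_V: "iray v \<Longrightarrow> v i \<in> V"
  unfolding iray_def using E_V1 by blast

lemma iray_edge: "iray v \<Longrightarrow> E (v i) (v (Suc i))"
  unfolding iray_def by blast

lemma iray_eq_iff: "iray v \<Longrightarrow> v i = v j \<longleftrightarrow> i = j"
  unfolding iray_def inj_def by blast

lemma iray_shift: "iray v \<Longrightarrow> iray (\<lambda>i. v (i + n))"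
  unfolding iray_def inj_def by (metis add_Suc add_right_cancel)

text \<open>The vertex \<open>v 1\<close> is never private, because \<open>v 2\<close> is adjacent
  to it.\<close>

lemma private_subset: "iray v \<Longrightarrow> private_nb v \<subseteq> nb (v 0) - {v 1}"
  unfolding private_nb_def using iray_edge[of v 1] E_sym by auto

lemma finite_private: "finite (private_nb v)"
  by (rule finite_subset[of _ "nb (v 0)"]) (auto simp: private_nb_def)

section \<open>Distance levels and the existence of an induced ray\<close>

definition level :: "'a \<Rightarrow> 'a \<Rightarrow> nat" where
  "level a x = (LEAST n. (E ^^ n) a x)"

lemma level_path: "a \<in> V \<Longrightarrow> x \<in> V \<Longrightarrow> (E ^^ level a x) a x"
proof -
  assume "a \<in> V" "x \<in> V"
  then have "E\<^sup>*\<^sup>* a x" using conn unfolding connected_graph_def by blast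
  then have "\<exists>n. (E ^^ n) a x" by (simp add: rtranclp_power)
  then show ?thesis unfolding level_def by (rule LeastI_ex)
qed

lemma level_edge: "a \<in> V \<Longrightarrow> E x y \<Longrightarrow> level a y \<le> Suc (level a x)"
proof -
  assume a: "a \<in> V" and xy: "E x y"
  have "(E ^^ Suc (level a x)) a y"
    using level_path[OF a E_V1[OF xy]] xy by auto
  then show ?thesis unfolding level_def[of a y] by (rule Least_le)
qed

lemma level_pred:
  assumes "a \<in> V" "x \<in> V" "level a x = Suc n"
  obtains y where "E y x" "level a y = n"
proof -
  have "(E ^^ Suc n) a x" using level_path[OF assms(1,2)] assms(3) by simp
  then obtain y where y: "(E ^^ n) a y" "E y x" by auto
  have "level a y \<le> n" unfolding level_def using y(1) by (rule Least_le)
  with level_edge[OF assms(1) y(2)] assms(3) have "level a y = n" by simp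
  with y that show thesis by blast
qed

lemma finite_level: "a \<in> V \<Longrightarrow> finite {x \<in> V. level a x = n}"
proof (induction n)
  case 0
  have "{x \<in> V. level a x = 0} \<subseteq> {a}"
    using level_path[OF 0] by (auto) (metis relpowp_0_E)
  then show ?case by (rule finite_subset) simp
next
  case (Suc n)
  have "{x \<in> V. level a x = Suc n} \<subseteq> (\<Union>y\<in>{x \<in> V. level a x = n}. nb y)"
  proof
    fix x assume "x \<in> {x \<in> V. level a x = Suc n}"
    then obtain y where "E y x" "level a y = n" using level_pred[OF Suc.prems] by blast
    then show "x \<in> (\<Union>y\<in>{x \<in> V. level a x = n}. nb y)" using E_V1 by auto
  qed
  moreover have "finite (\<Union>y\<in>{x \<in> V. level a x = n}. nb y)" using Suc by simp
  ultimately show ?case by (rule finite_subset)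
qed

text \<open>This supplies the enumeration \<open>to_nat_on V\<close>, which later keeps the
  exploration fair: no vertex waits forever.\<close>

lemma countable_V: "countable V"
proof -
  obtain a where a: "a \<in> V" using inf by (metis finite.emptyI equals0I)
  have "V = (\<Union>n. {x \<in> V. level a x = n})" by auto
  moreover have "countable (\<Union>n. {x \<in> V. level a x = n})"
    using finite_level[OF a] by (intro countable_UN) (auto intro: countable_finite)
  ultimately show ?thesis by simp
qed

text \<open>Koenig's lemma for the edges that lead one step away from \<open>a\<close>: as degrees
  are finite, a vertex with infinitely many descendants has a child with infinitely many. The
  resulting ray is geodesic from \<open>a\<close>, hence induced.\<close>

lemma ex_iray: "\<exists>v. iray v"
proof -
  obtain a where a: "a \<in> V" using inf by (metis finite.emptyI equals0I)
  define up where "up x y \<longleftrightarrow> E x y \<and> level a y = Suc (level a x)" for x y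
  define desc where "desc x = {y. up\<^sup>*\<^sup>* x y}" for x
  have "x \<in> desc a" if "x \<in> V" for x
    using that
  proof (induction "level a x" arbitrary: x)
    case 0
    then show ?case using level_path[OF a, of x] by (auto simp: desc_def)
  next
    case (Suc n)
    then obtain y where y: "E y x" "level a y = n" using level_pred[OF a] by metis
    then have "up\<^sup>*\<^sup>* a y" using Suc(1)[of y] E_V1 by (auto simp: desc_def)
    moreover have "up y x" using y Suc by (simp add: up_def)
    ultimately show ?case by (simp add: desc_def)
  qed
  then have inf_a: "infinite (desc a)" using inf by (meson finite_subset subsetI)
  have step: "\<exists>y. up x y \<and> infinite (desc y)" if "infinite (desc x)" for x
  proof (rule ccontr)
    assume no: "\<not> ?thesis"
    have "desc x \<subseteq> insert x (\<Union>y\<in>{y \<in> nb x. up x y}. desc y)"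
      unfolding desc_def by (auto elim: converse_rtranclpE simp: up_def)
    moreover have "finite (insert x (\<Union>y\<in>{y \<in> nb x. up x y}. desc y))"
      unfolding finite_insert
      by (rule finite_UN_I[OF finite_subset[OF _ finite_nb[of x]]]) (use no in auto)
    ultimately show False using that finite_subset by blast
  qed
  have "\<exists>v. v 0 = a \<and> (\<forall>n. infinite (desc (v n)) \<and> up (v n) (v (Suc n)))"
    \<comment> \<open>The clause for \<open>n = 0\<close> only pins the start of the chosen sequence
      to \<open>a\<close>.\<close>
    using dependent_nat_choice[of "\<lambda>n x. infinite (desc x) \<and> (n = 0 \<longrightarrow> x = a)" "\<lambda>_ x y. up x y"]
      inf_a step by auto
  then obtain v where v0: "v 0 = a" and up: "\<And>n. up (v n) (v (Suc n))" by blast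
  have lev: "level a (v n) = n" for n
  proof (induction n)
    case 0
    have "level a a \<le> 0" unfolding level_def by (rule Least_le) simp
    then show ?case by (simp add: v0)
  qed (use up in \<open>simp add: up_def\<close>)
  have edge: "E (v n) (v (Suc n))" for n using up by (simp add: up_def)
  have "iray v" unfolding iray_def
  proof (intro conjI allI iffI)
    show "inj v" by (rule injI) (metis lev)
    fix i j assume e: "E (v i) (v j)"
    have "j \<le> Suc i" "i \<le> Suc j" "i \<noteq> j"
      using level_edge[OF a e] level_edge[OF a E_sym[OF e]] lev e E_irrefl by auto
    then show "j = Suc i \<or> i = Suc j" by linarith
  qed (use edge E_sym in auto)
  then show ?thesis by blast
qed

section \<open>Automorphisms\<close>

lemma aut_edge: "automorphism V E \<gamma> \<Longrightarrow> x \<in> V \<Longrightarrow> y \<in> V \<Longrightarrow> E (\<gamma> x) (\<gamma> y) \<longleftrightarrow> E x y"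
  unfolding automorphism_def by blast

lemma aut_V: "automorphism V E \<gamma> \<Longrightarrow> x \<in> V \<Longrightarrow> \<gamma> x \<in> V"
  unfolding automorphism_def by (meson bij_betwE)

lemma aut_inj: "automorphism V E \<gamma> \<Longrightarrow> x \<in> V \<Longrightarrow> y \<in> V \<Longrightarrow> \<gamma> x = \<gamma> y \<longleftrightarrow> x = y"
  unfolding automorphism_def bij_betw_def by (meson inj_on_eq_iff)

lemma aut_surj: "automorphism V E \<gamma> \<Longrightarrow> y \<in> V \<Longrightarrow> \<exists>x\<in>V. \<gamma> x = y"
  unfolding automorphism_def bij_betw_def by (metis imageE)

lemma aut_inv:
  assumes "automorphism V E \<gamma>"
  obtains \<delta> where "automorphism V E \<delta>" "\<And>x. x \<in> V \<Longrightarrow> \<delta> (\<gamma> x) = x" "\<And>x. x \<in> V \<Longrightarrow> \<gamma> (\<delta> x) = x"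
proof -
  have b: "bij_betw \<gamma> V V" using assms by (simp add: automorphism_def)
  define \<delta> where "\<delta> = inv_into V \<gamma>"
  have d: "bij_betw \<delta> V V" unfolding \<delta>_def using b by (rule bij_betw_inv_into)
  have l: "\<delta> (\<gamma> x) = x" "\<gamma> (\<delta> x) = x" if "x \<in> V" for x
    using b that unfolding \<delta>_def by (simp_all add: bij_betw_inv_into_left bij_betw_inv_into_right)
  have "E x y \<longleftrightarrow> E (\<delta> x) (\<delta> y)" if "x \<in> V" "y \<in> V" for x y
    using aut_edge[OF assms, of "\<delta> x" "\<delta> y"] d that l by (auto simp: bij_betwE)
  then have "automorphism V E \<delta>" using d by (simp add: automorphism_def)
  then show thesis using l that by blast
qed

lemma aut_iray: "automorphism V E \<gamma> \<Longrightarrow> iray v \<Longrightarrow> iray (\<lambda>i. \<gamma> (v i))"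
  using iray_V[of v] unfolding iray_def inj_def by (simp add: aut_edge aut_inj)

text \<open>If \<open>v\<close> has fewer than \<open>k\<close> private neighbours, so has its
  image. This inequality is what rules out an image ray with \<open>k\<close> of them.\<close>

lemma card_private_aut:
  assumes g: "automorphism V E \<gamma>" and v: "iray v"
  shows "card (private_nb (\<lambda>i. \<gamma> (v i))) \<le> card (private_nb v)"
proof (rule surj_card_le[OF finite_private])
  show "private_nb (\<lambda>i. \<gamma> (v i)) \<subseteq> \<gamma> ` private_nb v"
  proof
    fix y assume y: "y \<in> private_nb (\<lambda>i. \<gamma> (v i))"
    then obtain x where x: "x \<in> V" "\<gamma> x = y"
      using aut_surj[OF g] E_V2 unfolding private_nb_def by blast
    have "x \<in> private_nb v"
      using y x iray_V[OF v] unfolding private_nb_def by (auto simp: aut_edge[OF g])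
    with x show "y \<in> \<gamma> ` private_nb v" by blast
  qed
qed

end

section \<open>The case in which every induced ray has \<open>k\<close> private neighbours: a
  regular tree\<close>

lemma prescribed_injection:
  assumes "finite A" "card A \<le> k" "a \<in> A" "e < k"
  shows "\<exists>f. inj_on f A \<and> f ` A \<subseteq> {..<k::nat} \<and> f a = e"
proof -
  have "card (A - {a}) \<le> card ({..<k} - {e})" using assms by simp
  then obtain f where f: "f ` (A - {a}) \<subseteq> {..<k} - {e}" "inj_on f (A - {a})"
    using card_le_inj[of "A - {a}" "{..<k} - {e}"] assms(1) by auto
  have "inj_on (f(a := e)) A" using f by (auto simp: inj_on_def image_subset_iff)
  moreover have "(f(a := e)) ` A \<subseteq> {..<k}" using f assms by (auto simp: image_subset_iff)
  ultimately show ?thesis by (intro exI[of _ "f(a := e)"]) simp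
qed

text \<open>The colours along the fixed ray; only two colours are certain to be available.\<close>

definition is_pow2 :: "nat \<Rightarrow> nat" where
  "is_pow2 i = (if \<exists>j. i = 2 ^ j then 1 else 0)"

lemma is_pow2_not_periodic:
  assumes "d > 0"
  shows "\<exists>i\<ge>N. is_pow2 (i + d) \<noteq> is_pow2 i"
proof -
  \<comment> \<open>This choice makes \<open>2 ^ j\<close> larger than both \<open>N\<close> and
    \<open>d\<close>, so \<open>2 ^ j + d\<close> falls strictly between two consecutive powers of
    2.\<close>
  define j where "j = N + d"
  have j: "j < 2 ^ j" by (rule less_exp)
  have "2 ^ j + d \<noteq> 2 ^ l" for l
  proof
    assume l: "2 ^ j + d = (2::nat) ^ l"
    then have "(2::nat) ^ j < 2 ^ l" using assms by linarith
    moreover have "(2::nat) ^ l < 2 ^ Suc j" using l j unfolding j_def power_Suc by linarith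
    ultimately have "j < l \<and> l < Suc j" by (metis one_less_numeral_iff power_less_imp_less_exp semiring_norm(76))
    then show False by linarith
  qed
  then have "is_pow2 (2 ^ j + d) \<noteq> is_pow2 (2 ^ j)" by (auto simp: is_pow2_def)
  moreover have "2 ^ j \<ge> N" using j unfolding j_def by linarith
  ultimately show ?thesis by blast
qed

locale all_private_graph = bounded_graph +
  fixes R :: "nat \<Rightarrow> 'a"
  assumes R: "iray R"
    and all_private: "\<And>v. iray v \<Longrightarrow> k \<le> card (private_nb v)"
begin

lemma private_eq:
  assumes "iray v" shows "private_nb v = nb (v 0) - {v 1}" "card (nb (v 0) - {v 1}) = k"
proof -
  have sub: "private_nb v \<subseteq> nb (v 0) - {v 1}" by (rule private_subset[OF assms])
  then have "card (private_nb v) \<le> card (nb (v 0) - {v 1})" by (rule card_mono[rotated]) simp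
  moreover have "v 1 \<in> nb (v 0)" using iray_edge[OF assms, of 0] by simp
  then have "card (nb (v 0) - {v 1}) \<le> k" using card_nb_le[of "v 0"] by simp
  moreover have "k \<le> card (private_nb v)" by (rule all_private[OF assms])
  ultimately have "card (private_nb v) = card (nb (v 0) - {v 1})" and *: "card (nb (v 0) - {v 1}) = k"
    by linarith+
  then show "private_nb v = nb (v 0) - {v 1}" by (intro card_subset_eq[OF _ sub]) simp
  show "card (nb (v 0) - {v 1}) = k" by (fact *)
qed

text \<open>With \<open>k\<close> private neighbours, every neighbour of \<open>v 0\<close> except
  \<open>v 1\<close> is private, so the new vertex sees nothing of the ray but
  \<open>v 0\<close>.\<close>

lemma iray_Cons:
  assumes v: "iray v" and x: "E (v 0) x" "x \<noteq> v 1"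
  shows "iray (case_nat x v)"
proof -
  have "x \<in> private_nb v" using private_eq(1)[OF v] x by simp
  then have no: "\<not> E (v (Suc j)) x" for j by (simp add: private_nb_def)
  have adj: "E x (v j) \<longleftrightarrow> j = 0" "E (v j) x \<longleftrightarrow> j = 0" for j
    using no x E_sym by (cases j; blast)+
  have ne: "x \<noteq> v j" for j
  proof
    assume e: "x = v j"
    then have "j = Suc 0 \<or> 0 = Suc j" using x(1) v unfolding iray_def by blast
    then show False using e x(2) by simp
  qed
  show ?thesis unfolding iray_def
  proof (intro conjI allI)
    show "inj (case_nat x v)"
      using v ne by (auto simp: inj_def iray_eq_iff split: nat.split)
    show "E (case_nat x v i) (case_nat x v j) \<longleftrightarrow> j = Suc i \<or> i = Suc j" for i j
      using v adj E_irrefl by (auto simp: iray_def split: nat.split)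
  qed
qed

text \<open>Agreement is only up to a shift, so that vertices can be added to or removed from the
  front.\<close>

definition tail :: "(nat \<Rightarrow> 'a) \<Rightarrow> bool" where
  "tail v \<longleftrightarrow> iray v \<and> (\<exists>m n. \<forall>i. v (i + m) = R (i + n))"

lemma tail_iray: "tail v \<Longrightarrow> iray v" by (simp add: tail_def)

lemma tail_R: "tail R" using R by (auto simp: tail_def)

lemma tail_shift: assumes "tail v" shows "tail (\<lambda>i. v (i + l))"
proof -
  obtain m n where mn: "\<And>i. v (i + m) = R (i + n)" using assms by (auto simp: tail_def)
  have "\<forall>i. v (i + m + l) = R (i + (n + l))" using mn[of "i + l" for i] by (simp add: ac_simps)
  then show ?thesis using assms iray_shift unfolding tail_def by blast
qed

lemma tail_Cons:
  assumes "tail v" "E (v 0) x" "x \<noteq> v 1" shows "tail (case_nat x v)"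
proof -
  obtain m n where "\<And>i. v (i + m) = R (i + n)" using assms by (auto simp: tail_def)
  then have "\<forall>i. case_nat x v (i + Suc m) = R (i + n)" by simp
  then show ?thesis using iray_Cons assms unfolding tail_def by blast
qed

lemma tail_nb:
  assumes "tail v" "E (v 0) x" shows "\<exists>w. tail w \<and> w 0 = x"
proof (cases "x = v 1")
  case True
  then show ?thesis using tail_shift[OF assms(1), of 1] by (intro exI[of _ "\<lambda>i. v (i + 1)"]) simp
next
  case False
  then show ?thesis using tail_Cons assms by (intro exI[of _ "case_nat x v"]) simp
qed

lemma ex_tail: assumes "x \<in> V" shows "\<exists>v. tail v \<and> v 0 = x"
proof -
  have "E\<^sup>*\<^sup>* (R 0) x" using conn assms iray_V[OF R] unfolding connected_graph_def by blast
  then show ?thesis by (induction rule: rtranclp_induct) (use tail_R tail_nb in blast)+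
qed

lemma tail_unique:
  assumes v: "tail v" and w: "tail w" and eq: "v 0 = w 0"
  shows "v 1 = w 1"
proof (rule ccontr)
  assume ne: "v 1 \<noteq> w 1"
  \<comment> \<open>Prepending \<open>w\<close> backwards to \<open>v\<close> never gets stuck, although both end in the same tail.\<close>
  have ir: "iray (\<lambda>i. if i \<le> n then w (n - i) else v (i - n))" for n
  proof (induction n)
    case 0
    have "(\<lambda>i. if i \<le> 0 then w (0 - i) else v (i - 0)) = v" using eq by auto
    then show ?case using tail_iray[OF v] by simp
  next
    case (Suc n)
    let ?u = "\<lambda>i. if i \<le> n then w (n - i) else v (i - n)"
    have "E (?u 0) (w (Suc n))" using iray_edge[OF tail_iray[OF w]] by simp
    moreover have "w (Suc n) \<noteq> ?u 1" using ne iray_eq_iff[OF tail_iray[OF w]] by (cases n) auto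
    ultimately have "iray (case_nat (w (Suc n)) ?u)" by (rule iray_Cons[OF Suc.IH])
    moreover have "case_nat (w (Suc n)) ?u = (\<lambda>i. if i \<le> Suc n then w (Suc n - i) else v (i - Suc n))"
      by (rule ext) (simp split: nat.split)
    ultimately show ?case by simp
  qed
  obtain m n where mn: "\<And>i. v (i + m) = R (i + n)" using v by (auto simp: tail_def)
  obtain m' n' where mn': "\<And>i. w (i + m') = R (i + n')" using w by (auto simp: tail_def)
  \<comment> \<open>Both sides are \<open>R (Suc (n + n'))\<close>. In the concatenated ray this
    vertex would occur at position 0 and at a later position, against injectivity.\<close>
  have "w (Suc n + m') = v (Suc n' + m)" using mn[of "Suc n'"] mn'[of "Suc n"] by (simp add: ac_simps)
  then show False using iray_eq_iff[OF ir[of "Suc n + m'"], of 0 "Suc n + m' + (Suc n' + m)"] by simp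
qed

text \<open>The parent: the next vertex on the way to the end of \<^term>\<open>R\<close>.\<close>

definition pi :: "'a \<Rightarrow> 'a" where
  "pi x = (SOME v. tail v \<and> v 0 = x) 1"

text \<open>By \<open>tail_unique\<close> the choice made in \<open>pi\<close> is
  immaterial.\<close>

lemma pi_tail: assumes "tail v" shows "pi (v i) = v (Suc i)"
proof -
  have t: "tail (\<lambda>j. v (j + i))" by (rule tail_shift[OF assms])
  have "tail (SOME w. tail w \<and> w 0 = v i) \<and> (SOME w. tail w \<and> w 0 = v i) 0 = v i"
    by (rule someI[of "\<lambda>w. tail w \<and> w 0 = v i" "\<lambda>j. v (j + i)"]) (use t in simp)
  then show ?thesis using tail_unique[OF t, of "SOME w. tail w \<and> w 0 = v i"] by (simp add: pi_def)
qed

lemma E_pi: assumes "x \<in> V" shows "E x (pi x)"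
proof -
  obtain v where "tail v" "v 0 = x" using ex_tail assms by blast
  then show ?thesis using pi_tail[of v 0] iray_edge[of v 0] tail_iray by auto
qed

lemma pi_pi: assumes "x \<in> V" shows "pi (pi x) \<noteq> x"
proof -
  obtain v where "tail v" "v 0 = x" using ex_tail assms by blast
  then show ?thesis using pi_tail[of v 0] pi_tail[of v 1] iray_eq_iff[of v 2 0] tail_iray
    by (auto simp: numeral_2_eq_2)
qed

text \<open>If \<open>y\<close> is not the next vertex on the ray from \<open>x\<close> towards the
  end of \<open>R\<close>, it can be prepended to that ray, and then \<open>x\<close> comes next
  after \<open>y\<close>.\<close>

lemma pi_cases: assumes "E x y" shows "y = pi x \<or> pi y = x"
proof -
  obtain v where v: "tail v" "v 0 = x" using ex_tail E_V1[OF assms] by blast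
  show ?thesis
  proof (cases "y = v 1")
    case True
    then show ?thesis using v pi_tail[of v 0] by simp
  next
    case False
    then have "tail (case_nat y v)" using tail_Cons v assms by simp
    from pi_tail[OF this, of 0] v show ?thesis by simp
  qed
qed

lemma children: assumes "y \<in> V" shows "{x \<in> V. pi x = y} = nb y - {pi y}"
  using E_pi E_sym pi_cases pi_pi E_V2 by fastforce

lemma card_children: assumes "y \<in> V" shows "card {x \<in> V. pi x = y} = k"
proof -
  obtain v where "tail v" "v 0 = y" using ex_tail assms by blast
  then show ?thesis using private_eq(2)[of v] pi_tail[of v 0] children[OF assms] tail_iray by simp
qed

lemma iter_pi_R: assumes "x \<in> V" shows "\<exists>n0. \<exists>m. \<forall>i. (pi ^^ (i + n0)) x = R (i + m)"
proof -
  obtain v where v: "tail v" "v 0 = x" using ex_tail assms by blast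
  have "(pi ^^ i) x = v i" for i by (induction i) (use v pi_tail in auto)
  then show ?thesis using v(1) unfolding tail_def by metis
qed

lemma ex_colouring:
  "\<exists>c. (\<forall>x\<in>V. c x < k) \<and> (\<forall>x\<in>V. \<forall>y\<in>V. pi x = pi y \<longrightarrow> c x = c y \<longrightarrow> x = y) \<and> (\<forall>i. c (R i) = is_pow2 i)"
proof -
  \<comment> \<open>Each set of siblings is coloured separately. At most one sibling lies on
    \<open>R\<close>, so at most one colour per set is prescribed.\<close>
  have "\<forall>y\<in>V. \<exists>f. inj_on f {x \<in> V. pi x = y} \<and> f ` {x \<in> V. pi x = y} \<subseteq> {..<k} \<and> (\<forall>i. y = R (Suc i) \<longrightarrow> f (R i) = is_pow2 i)"
  proof
    fix y assume y: "y \<in> V"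
    let ?A = "{x \<in> V. pi x = y}"
    have cA: "card ?A = k" by (rule card_children[OF y])
    then have fA: "finite ?A" using k2 by (intro card_ge_0_finite) simp
    show "(\<exists>f. inj_on f ?A \<and> f ` ?A \<subseteq> {..<k} \<and> (\<forall>i. y = R (Suc i) \<longrightarrow> f (R i) = is_pow2 i))"
    proof (cases "\<exists>i. y = R (Suc i)")
      case True
      then obtain i where i: "y = R (Suc i)" ..
      have "R i \<in> ?A" using pi_tail[OF tail_R] i iray_V[OF R] by simp
      moreover have "is_pow2 i < k" using k2 by (simp add: is_pow2_def)
      ultimately obtain f where "inj_on f ?A \<and> f ` ?A \<subseteq> {..<k} \<and> f (R i) = is_pow2 i"
        using prescribed_injection[of ?A k "R i" "is_pow2 i"] cA fA by auto
      then show ?thesis using i iray_eq_iff[OF R] by (intro exI[of _ f]) auto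
    next
      case False
      obtain f where "f ` ?A \<subseteq> {..<k}" "inj_on f ?A" using card_le_inj[of ?A "{..<k}"] cA fA by auto
      then show ?thesis using False by blast
    qed
  qed
  from bchoice[OF this] obtain f where "\<forall>y\<in>V. inj_on (f y) {x \<in> V. pi x = y} \<and>
      f y ` {x \<in> V. pi x = y} \<subseteq> {..<k} \<and> (\<forall>i. y = R (Suc i) \<longrightarrow> f y (R i) = is_pow2 i)" ..
  then have f: "\<And>y. y \<in> V \<Longrightarrow> inj_on (f y) {x \<in> V. pi x = y}"
    "\<And>y. y \<in> V \<Longrightarrow> f y ` {x \<in> V. pi x = y} \<subseteq> {..<k}"
    "\<And>y i. y \<in> V \<Longrightarrow> y = R (Suc i) \<Longrightarrow> f y (R i) = is_pow2 i" by blast+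
  have piV: "pi x \<in> V" if "x \<in> V" for x using E_pi[OF that] E_V2 by blast
  show ?thesis
  proof (intro exI[of _ "\<lambda>x. f (pi x) x"] conjI ballI allI impI)
    fix x assume x: "x \<in> V"
    then show "f (pi x) x < k" using f(2)[OF piV[OF x]] by auto
    fix y assume "y \<in> V" "pi x = pi y" "f (pi x) x = f (pi y) y"
    then show "x = y" using f(1)[OF piV[OF x]] x by (auto dest: inj_onD)
  next
    fix i show "f (pi (R i)) (R i) = is_pow2 i"
      using f(3)[OF iray_V[OF R] refl] pi_tail[OF tail_R] by simp
  qed
qed

lemma ex_distinguishing_all_private: "\<exists>c. distinguishing_colouring V E k c"
proof -
  obtain c where ck: "\<And>x. x \<in> V \<Longrightarrow> c x < k"
    and ci: "\<And>x y. x \<in> V \<Longrightarrow> y \<in> V \<Longrightarrow> pi x = pi y \<Longrightarrow> c x = c y \<Longrightarrow> x = y"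
    and cR: "\<And>i. c (R i) = is_pow2 i"
    using ex_colouring by metis
  \<comment> \<open>\<open>k\<close> siblings with distinct colours below \<open>k\<close> use every
    colour.\<close>
  have onto: "\<exists>x\<in>V. pi x = y \<and> c x = e" if y: "y \<in> V" and e: "e < k" for y e
  proof -
    have "c ` {x \<in> V. pi x = y} = {..<k}"
    proof (rule card_subset_eq)
      show "card (c ` {x \<in> V. pi x = y}) = card {..<k}"
      proof (subst card_image)
        show "inj_on c {x \<in> V. pi x = y}" by (rule inj_onI, rule ci) auto
      qed (simp add: card_children[OF y])
    qed (use ck in auto)
    then have "e \<in> c ` {x \<in> V. pi x = y}" using e by simp
    then show ?thesis by auto
  qed
  have "\<forall>x\<in>V. \<gamma> x = x" if g: "automorphism V E \<gamma>" and gc: "\<And>x. x \<in> V \<Longrightarrow> c (\<gamma> x) = c x" for \<gamma>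
  proof -
    define S where "S i = \<gamma> (R i)" for i
    have S: "iray S" unfolding S_def by (rule aut_iray[OF g R])
    have cS: "c (S i) = is_pow2 i" for i using gc[OF iray_V[OF R]] cR by (simp add: S_def)
    have up: "pi (S i) = S (Suc i)" for i
    proof (rule ccontr)
      assume "pi (S i) \<noteq> S (Suc i)"
      then have d0: "pi (S (Suc i)) = S i" using pi_cases[OF iray_edge[OF S, of i]] by simp
      \<comment> \<open>Having once stepped to a child, the ray keeps descending: the only way up
        would lead back to the vertex just left.\<close>
      have d: "pi (S (Suc j)) = S j" if "i \<le> j" for j
        using that
      proof (induction rule: dec_induct)
        case (step n)
        then show ?case using pi_cases[OF iray_edge[OF S, of "Suc n"]] iray_eq_iff[OF S, of "Suc (Suc n)" n] by simp
      qed (rule d0)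
      \<comment> \<open>Among the k children of \<open>S (j + 1)\<close> one has the colour of \<open>R j\<close>. Its preimage is a neighbour
        of \<open>R (j + 1)\<close>, but not \<open>R j\<close>, which maps to the parent; so it is \<open>R (j + 2)\<close>.\<close>
      have "is_pow2 (j + 2) = is_pow2 j" if j: "i \<le> j" for j
      proof (rule ccontr)
        assume ne: "is_pow2 (j + 2) \<noteq> is_pow2 j"
        have SV: "S (Suc j) \<in> V" by (rule iray_V[OF S])
        have "is_pow2 j < k" using k2 by (simp add: is_pow2_def)
        then obtain x where x: "x \<in> V" "pi x = S (Suc j)" "c x = is_pow2 j" using onto[OF SV] by metis
        obtain y where y: "y \<in> V" "\<gamma> y = x" using aut_surj[OF g x(1)] by blast
        have "E x (S (Suc j))" using E_pi[OF x(1)] x(2) by simp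
        then have "E y (R (Suc j))" using aut_edge[OF g y(1) iray_V[OF R, of "Suc j"]] y(2) by (simp add: S_def)
        then have "E (R (Suc j)) y" by (rule E_sym)
        from pi_cases[OF this] show False
        proof
          assume "y = pi (R (Suc j))"
          then have "y = R (j + 2)" using pi_tail[OF tail_R] by simp
          then show False using ne x(3) y gc[of y] cR by simp
        next
          assume "pi y = R (Suc j)"
          then have "pi y = pi (R j)" using pi_tail[OF tail_R] by simp
          moreover have "c y = c (R j)" using x(3) y gc[of y] cR by simp
          ultimately have "y = R j" by (rule ci[OF y(1) iray_V[OF R]])
          then have "x = S j" using y by (simp add: S_def)
          then have "pi (S j) = S (Suc j)" using x by simp
          then show False using d[OF j] pi_pi[OF iray_V[OF S, of j]] by simp
        qed
      qed
      then show False using is_pow2_not_periodic[of 2 i] by auto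
    qed
    have it: "(pi ^^ i) (S 0) = S i" for i by (induction i) (use up in auto)
    then obtain m n where mn: "\<And>i. S (i + m) = R (i + n)"
      using iter_pi_R[OF iray_V[OF S, of 0]] by metis
    have per: "is_pow2 (i + m) = is_pow2 (i + n)" for i using cS[of "i + m"] mn cR by simp
    \<comment> \<open>Otherwise the colours along \<open>R\<close> would eventually have period
      \<bar>m - n\<bar>.\<close>
    have "m = n"
    proof (rule ccontr)
      assume ne: "m \<noteq> n"
      define a b where "a = min m n" and "b = max m n"
      have "is_pow2 (i + a) = is_pow2 (i + b)" for i using per by (auto simp: a_def b_def min_def max_def)
      then have "is_pow2 (i + (b - a)) = is_pow2 i" if "a \<le> i" for i
        using that ne by (metis (no_types, lifting) a_def add.commute add_diff_assoc b_def le_add_diff_inverse2 max.coboundedI1 min.cobounded1)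
      moreover have "b - a > 0" using ne by (auto simp: a_def b_def)
      ultimately show False using is_pow2_not_periodic[of "b - a" a] by auto
    qed
    then have fixR: "\<gamma> (R (i + n)) = R (i + n)" for i using mn by (simp add: S_def)
    \<comment> \<open>Since \<open>\<gamma>\<close> fixes a tail of \<open>R\<close>, it maps rays
      that end in \<open>R\<close> to rays that end in \<open>R\<close>, and \<open>pi\<close> moves
      one step along such rays.\<close>
    have comm: "pi (\<gamma> x) = \<gamma> (pi x)" if x: "x \<in> V" for x
    proof -
      obtain v where v: "tail v" "v 0 = x" using ex_tail x by blast
      obtain p q where pq: "\<And>i. v (i + p) = R (i + q)" using v(1) by (auto simp: tail_def)
      have "\<gamma> (v (i + (p + n))) = R (i + (q + n))" for i
        using pq[of "i + n"] fixR[of "i + q"] by (simp add: ac_simps)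
      then have "tail (\<lambda>i. \<gamma> (v i))" unfolding tail_def using aut_iray[OF g tail_iray[OF v(1)]] by blast
      from pi_tail[OF this, of 0] pi_tail[OF v(1), of 0] v(2) show ?thesis by simp
    qed
    \<comment> \<open>Induction on the number of steps up to the fixed part of \<open>R\<close>: if
      the parent is fixed, \<open>x\<close> and its image are siblings of the same colour.\<close>
    have "\<gamma> x = x" if "x \<in> V" "(pi ^^ l) x = R (i + n)" for l i x
      using that
    proof (induction l arbitrary: x)
      case 0
      then show ?case using fixR by simp
    next
      case (Suc l)
      have "pi x \<in> V" using E_pi[OF Suc.prems(1)] E_V2 by blast
      moreover have "(pi ^^ l) (pi x) = R (i + n)" using Suc.prems(2) by (simp only: funpow_Suc_right o_apply)
      ultimately have "\<gamma> (pi x) = pi x" by (rule Suc.IH)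
      then have "pi (\<gamma> x) = pi x" using comm Suc.prems by simp
      then show ?case by (rule ci[OF aut_V[OF g Suc.prems(1)] Suc.prems(1) _ gc[OF Suc.prems(1)]])
    qed
    moreover have "\<exists>l i. (pi ^^ l) x = R (i + n)" if "x \<in> V" for x
      using iter_pi_R[OF that] by (metis add.commute)
    ultimately show ?thesis by blast
  qed
  then show ?thesis unfolding distinguishing_colouring_def using ck by blast
qed

end

section \<open>The case of an induced ray with slack: exploring the graph from it\<close>

lemma avoiding_injection:
  assumes "finite A" "card A \<le> k"
  shows "\<exists>f. inj_on f A \<and> f ` A \<subseteq> {..<k::nat} \<and> (card A < k \<longrightarrow> 0 \<notin> f ` A)"
proof (cases "card A < k")
  case True
  then have "card A \<le> card {1..<k}" by simp
  then obtain f where "f ` A \<subseteq> {1..<k}" "inj_on f A" using card_le_inj[OF assms(1)] by blast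
  then show ?thesis by (intro exI[of _ f]) (auto simp: image_subset_iff)
next
  case False
  have "card A \<le> card {..<k}" using assms(2) by simp
  then obtain f where "f ` A \<subseteq> {..<k}" "inj_on f A" using card_le_inj[OF assms(1)] by blast
  with False show ?thesis by blast
qed

locale slack_graph = bounded_graph +
  fixes v :: "nat \<Rightarrow> 'a"
  assumes v: "iray v" and slack: "card (private_nb v) < k"
begin

definition K :: "'a set" where "K = range v"

definition F0 :: "'a set" where "F0 = K \<union> (\<Union>x\<in>K. nb x)"

definition top :: "'a \<Rightarrow> nat" where "top x = Max {j. E (v j) x}"

definition active :: "'a set \<Rightarrow> 'a \<Rightarrow> bool" where
  "active A q \<longleftrightarrow> q \<in> A \<and> \<not> nb q \<subseteq> A"

definition full :: "'a set \<Rightarrow> 'a \<Rightarrow> bool" where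
  "full A q \<longleftrightarrow> card (nb q - A) = k"

definition least :: "'a set \<Rightarrow> 'a" where
  "least A = (SOME q. active A q \<and> (\<forall>r. active A r \<longrightarrow> to_nat_on V q \<le> to_nat_on V r))"

text \<open>
A vertex with \<^term>\<open>k\<close> new neighbours (a full one) gives colour 0 to one of them. It has to wait
for every vertex that is not full and shares a new neighbour with it: this way each neighbour explored
before a vertex of colour 0 is full when that vertex is explored.
\<close>

definition rival :: "'a set \<Rightarrow> 'a \<Rightarrow> 'a \<Rightarrow> bool" where
  "rival A l q \<longleftrightarrow> active A q \<and> \<not> full A q \<and> (nb q - A) \<inter> (nb l - A) \<noteq> {}"

definition chosen :: "'a set \<Rightarrow> 'a" where
  "chosen A = (if full A (least A) \<and> (\<exists>q. rival A (least A) q)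
     then SOME q. rival A (least A) q else least A)"

primrec F :: "nat \<Rightarrow> 'a set" where
  "F 0 = F0"
| "F (Suc n) = F n \<union> nb (chosen (F n))"

definition p :: "nat \<Rightarrow> 'a" where "p n = chosen (F n)"

text \<open>Once \<open>F n\<close> is all of \<open>V\<close>, the vertex \<open>p n\<close> is
  unspecified, but this set is empty whatever it is.\<close>

definition U :: "nat \<Rightarrow> 'a set" where "U n = nb (p n) - F n"

lemma F_Suc: "F (Suc n) = F n \<union> U n"
  by (auto simp: U_def p_def)

lemma v_K [simp]: "v i \<in> K" by (simp add: K_def)

lemma K_F0: "K \<subseteq> F0" by (auto simp: F0_def)

lemma F_mono: "m \<le> n \<Longrightarrow> F m \<subseteq> F n"
  by (rule lift_Suc_mono_le[of F]) auto

lemma F0_F: "F0 \<subseteq> F n" using F_mono[of 0 n] by simp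

lemma F_V: "F n \<subseteq> V"
proof (induction n)
  case 0
  then show ?case using iray_V[OF v] E_V2 by (auto simp: F0_def K_def)
qed (use E_V2 in auto)

lemma K_nb: "x \<in> K \<Longrightarrow> E x y \<Longrightarrow> y \<in> F n"
  using F0_F[of n] nb_iff[of y x] unfolding F0_def by blast

lemma F_ne: "F n \<noteq> {}" using F0_F[of n] K_F0 v_K by blast

lemma active_least:
  assumes "A \<noteq> {}" "A \<subseteq> V" "A \<noteq> V"
  shows "active A (least A)" "\<And>r. active A r \<Longrightarrow> to_nat_on V (least A) \<le> to_nat_on V r"
proof -
  obtain q where "active A q" using boundary_edge[OF assms] by (metis active_def nb_iff subsetD)
  then have "\<exists>q. active A q \<and> (\<forall>r. active A r \<longrightarrow> to_nat_on V q \<le> to_nat_on V r)"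
    using ex_has_least_nat[of "active A" q "to_nat_on V"] by blast
  then have "active A (least A) \<and> (\<forall>r. active A r \<longrightarrow> to_nat_on V (least A) \<le> to_nat_on V r)"
    unfolding least_def by (rule someI_ex)
  then show "active A (least A)" "\<And>r. active A r \<Longrightarrow> to_nat_on V (least A) \<le> to_nat_on V r" by auto
qed

lemma chosen_cases:
  obtains (rival) "full A (least A)" "rival A (least A) (chosen A)"
  | (least) "chosen A = least A" "\<not> full A (least A) \<or> (\<forall>q. \<not> rival A (least A) q)"
proof (cases "full A (least A) \<and> (\<exists>q. rival A (least A) q)")
  case True
  then have "chosen A = (SOME q. rival A (least A) q)" by (simp add: chosen_def)
  then have "rival A (least A) (chosen A)" using True someI_ex[of "rival A (least A)"] by simp
  then show thesis using rival True by blast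
next
  case False
  then have "chosen A = least A" unfolding chosen_def by (rule if_not_P)
  then show thesis using least False by blast
qed

lemma active_p: assumes "F n \<noteq> V" shows "active (F n) (p n)"
  unfolding p_def using active_least(1)[OF F_ne F_V assms]
  by (cases rule: chosen_cases[of "F n"]) (auto simp: rival_def)

text \<open>A vertex chosen as a rival is not full, and a full least vertex is chosen only when it
  has no rival.\<close>

lemma full_p: assumes "full (F n) (p n)" shows "\<not> rival (F n) (p n) q"
  using assms unfolding p_def by (cases rule: chosen_cases[of "F n"]) (auto simp: rival_def)

lemma U_D: assumes "x \<in> U n" shows "E (p n) x" "x \<notin> F n" "p n \<in> F n" "p n \<notin> K"
proof -
  show 1: "E (p n) x" "x \<notin> F n" using assms by (auto simp: U_def)
  then have "F n \<noteq> V" using E_V2 by blast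
  then show "p n \<in> F n" using active_p by (simp add: active_def)
  show "p n \<notin> K" using K_nb 1 by blast
qed

lemma F_cases: assumes "x \<in> F n" "x \<notin> F0" obtains m where "m < n" "x \<in> U m"
  using assms
proof (induction n arbitrary: thesis)
  case (Suc n)
  then show ?case using F_Suc[of n] by (metis UnE less_Suc_eq)
qed simp

lemma earlier_nb: assumes "x \<in> F n" "x \<notin> K" shows "\<exists>y\<in>F n. E x y"
proof (cases "x \<in> F0")
  case True
  then show ?thesis using assms E_sym K_F0 F0_F[of n] unfolding F0_def by fastforce
next
  case False
  then obtain m where m: "m < n" "x \<in> U m" using F_cases assms by blast
  then show ?thesis using U_D[OF m(2)] F_mono[of m n] E_sym by auto
qed

lemma finite_U: "finite (U n)" by (simp add: U_def)

text \<open>One of the at most \<open>k + 1\<close> neighbours is already explored.\<close>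

lemma card_new:
  assumes "x \<in> F n" "x \<notin> K" shows "card (nb x - F n) \<le> k"
proof -
  obtain y where "y \<in> F n" "E x y" using earlier_nb[OF assms] by blast
  then have "nb x - F n \<subseteq> nb x - {y}" "y \<in> nb x" by auto
  then have "card (nb x - F n) \<le> card (nb x) - 1"
    by (metis card_Diff_singleton card_mono finite_Diff finite_nb)
  then show ?thesis using card_nb_le[of x] by simp
qed

lemma card_U: "card (U n) \<le> k"
proof (cases "U n = {}")
  case False
  then obtain x where "x \<in> U n" by blast
  then show ?thesis using U_D(3,4) card_new[of "p n" n] by (simp add: U_def)
qed simp

text \<open>Degree at most \<open>k + 1\<close> and \<open>k\<close> unexplored neighbours leave
  room for one explored neighbour.\<close>

lemma full_unique:
  assumes "full (F n) x" "E x y" "E x z" "y \<in> F n" "z \<in> F n"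
  shows "y = z"
proof (rule ccontr)
  assume "y \<noteq> z"
  then have "card {y, z} = 2" by simp
  moreover have "{y, z} \<subseteq> nb x" using assms by auto
  ultimately have "card (nb x - {y, z}) = card (nb x) - 2" by (metis card_Diff_subset finite.emptyI finite_insert)
  moreover have "card (nb x - F n) \<le> card (nb x - {y, z})" by (rule card_mono) (use assms in auto)
  ultimately show False using assms(1) card_nb_le[of x] k2 by (simp add: full_def)
qed

text \<open>
Once all vertices of smaller index are inactive forever, an active \<^term>\<open>q\<close> is the least one. Then it
is chosen after at most one rival, since exploring the rival makes it stop being full.
\<close>

lemma eventually_exhausted: "q \<in> F n \<Longrightarrow> \<exists>m. nb q \<subseteq> F m"
proof (induction "to_nat_on V q" arbitrary: q n rule: less_induct)
  case less
  let ?A = "{r \<in> V. to_nat_on V r < to_nat_on V q}"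
  have "inj_on (to_nat_on V) ?A"
    using inj_on_to_nat_on[OF countable_V] by (rule inj_on_subset) auto
  moreover have "to_nat_on V ` ?A \<subseteq> {..<to_nat_on V q}" by auto
  ultimately have fin: "finite ?A" by (meson finite_lessThan finite_subset finite_imageD)
  have "eventually (\<lambda>m. \<forall>r\<in>?A. \<not> active (F m) r) sequentially"
  proof (rule eventually_ball_finite[OF fin], rule ballI)
    fix r assume r: "r \<in> ?A"
    show "eventually (\<lambda>m. \<not> active (F m) r) sequentially"
    proof (cases "\<exists>m. r \<in> F m")
      case True
      then obtain m where "nb r \<subseteq> F m" using less.hyps r by blast
      then have "\<not> active (F j) r" if "m \<le> j" for j using F_mono[OF that] by (auto simp: active_def)
      then show ?thesis unfolding eventually_sequentially by blast
    qed (simp add: active_def)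
  qed
  then obtain M0 where M0: "\<And>m r. M0 \<le> m \<Longrightarrow> r \<in> ?A \<Longrightarrow> \<not> active (F m) r"
    unfolding eventually_sequentially by blast
  have least: "least (F m) = q" if m: "M0 \<le> m" and a: "active (F m) q" for m
  proof -
    have "F m \<noteq> V" using a E_V2 by (auto simp: active_def)
    note l = active_least[OF F_ne F_V this]
    have lV: "least (F m) \<in> V" using l(1) F_V by (auto simp: active_def)
    have qV: "q \<in> V" using a F_V by (auto simp: active_def)
    have "\<not> to_nat_on V (least (F m)) < to_nat_on V q" using M0[OF m, of "least (F m)"] l(1) lV by auto
    then have "to_nat_on V (least (F m)) = to_nat_on V q" using l(2)[OF a] by simp
    then show ?thesis using inj_on_to_nat_on[OF countable_V] lV qV by (auto dest: inj_onD)
  qed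
  define M where "M = max M0 n"
  have qM: "q \<in> F m" if "M \<le> m" for m using less.prems F_mono[of n m] that by (auto simp: M_def)
  show ?case
  proof (rule ccontr)
    assume no: "\<nexists>m. nb q \<subseteq> F m"
    then have act: "active (F m) q" if "M \<le> m" for m using qM[OF that] by (simp add: active_def)
    have l: "least (F m) = q" if "M \<le> m" for m using least act that by (simp add: M_def)
    have ch: "chosen (F m) \<noteq> q" for m
      using no F.simps(2)[of m] by blast
    have "full (F m) q \<and> rival (F m) q (chosen (F m))" if "M \<le> m" for m
      using ch[of m] l[OF that] by (cases rule: chosen_cases[of "F m"]) auto
    then have fM: "full (F M) q" and rM: "rival (F M) q (chosen (F M))" and fM1: "full (F (Suc M)) q"
      using le_refl[of M] le_SucI[OF le_refl[of M]] by blast+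
    obtain z where "z \<in> nb q - F M" "z \<in> nb (chosen (F M))" using rM unfolding rival_def by blast
    then have "nb q - F (Suc M) \<subset> nb q - F M" by auto
    then have "card (nb q - F (Suc M)) < card (nb q - F M)" by (intro psubset_card_mono) auto
    then show False using fM fM1 by (simp add: full_def)
  qed
qed

lemma Union_F: "(\<Union>n. F n) = V"
proof (rule ccontr)
  assume ne: "(\<Union>n. F n) \<noteq> V"
  have "(\<Union>n. F n) \<noteq> {}" "(\<Union>n. F n) \<subseteq> V" using F_ne F_V by auto
  from boundary_edge[OF this ne] obtain q x where "q \<in> (\<Union>n. F n)" "E q x" "x \<notin> (\<Union>n. F n)" .
  then show False using eventually_exhausted by (metis UN_E UN_I UNIV_I nb_iff subsetD)
qed

lemma U_ex: assumes "x \<in> V" "x \<notin> F0" shows "\<exists>n. x \<in> U n"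
proof -
  obtain n where "x \<in> F n" using assms Union_F by blast
  then show ?thesis using F_cases assms by metis
qed

lemma U_later: assumes "x \<in> U n" shows "x \<in> F m \<longleftrightarrow> n < m"
proof
  show "x \<in> F m \<Longrightarrow> n < m" using U_D(2)[OF assms] F_mono[of m n] by (metis not_less subsetD)
  show "n < m \<Longrightarrow> x \<in> F m" using assms F_Suc[of n] F_mono[of "Suc n" m] by auto
qed

lemma U_unique: assumes "x \<in> U m" "x \<in> U n" shows "m = n"
  using U_later[OF assms(1)] U_later[OF assms(2)] by (metis nat_neq_iff)

section \<open>The greedy colouring\<close>

lemma top:
  assumes "x \<in> F0" "x \<notin> K" shows "E (v (top x)) x" "E (v j) x \<Longrightarrow> j \<le> top x"
proof -
  let ?J = "{j. E (v j) x}"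
  have "v ` ?J \<subseteq> nb x" using E_sym by auto
  then have "finite (v ` ?J)" by (rule finite_subset) simp
  then have fin: "finite ?J" by (rule finite_imageD) (use v in \<open>auto simp: iray_eq_iff inj_on_def\<close>)
  have "?J \<noteq> {}" using assms by (auto simp: F0_def K_def)
  from Max_in[OF fin this] show "E (v (top x)) x" by (simp add: top_def)
  show "j \<le> top x" if "E (v j) x" unfolding top_def by (rule Max_ge[OF fin]) (use that in simp)
qed

definition C :: "nat \<Rightarrow> 'a set" where "C j = {x \<in> F0 - K. top x = j}"

text \<open>An inner vertex of the ray spends two of its neighbours on the ray itself. For
  \<open>j = 0\<close> only one is spent, but the class consists of private neighbours, and the
  slack bounds those. Hence the \<open>k - 1\<close> nonzero colours suffice for each class.\<close>

lemma card_C: "finite (C j)" "card (C j) < k"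
proof -
  have sub: "C j \<subseteq> nb (v j) - K" using top(1) by (auto simp: C_def)
  then show "finite (C j)" by (rule finite_subset) simp
  show "card (C j) < k"
  proof (cases j)
    case 0
    have "C j \<subseteq> private_nb v" using top 0 by (fastforce simp: C_def private_nb_def)
    then have "card (C j) \<le> card (private_nb v)" by (rule card_mono[OF finite_private])
    then show ?thesis using slack by simp
  next
    case (Suc i)
    have "card {v i, v (Suc j)} = 2" using iray_eq_iff[OF v] Suc by simp
    moreover have "{v i, v (Suc j)} \<subseteq> nb (v j)" using iray_edge[OF v] E_sym Suc by auto
    ultimately have "card (nb (v j) - {v i, v (Suc j)}) = card (nb (v j)) - 2"
      by (metis card_Diff_subset finite.emptyI finite_insert)
    moreover have "card (C j) \<le> card (nb (v j) - {v i, v (Suc j)})" by (rule card_mono) (use sub in auto)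
    ultimately show ?thesis using card_nb_le[of "v j"] k2 by simp
  qed
qed

text \<open>Within \<open>F0\<close> the colour 0 marks exactly the ray; outside, it can appear only
  when a full vertex is explored.\<close>

definition is_greedy :: "('a \<Rightarrow> nat) \<Rightarrow> bool" where
  "is_greedy c \<longleftrightarrow> (\<forall>x\<in>V. c x < k) \<and> (\<forall>x\<in>K. c x = 0) \<and> (\<forall>x\<in>F0 - K. c x \<noteq> 0)
     \<and> (\<forall>j. inj_on c (C j)) \<and> (\<forall>n. inj_on c (U n) \<and> (\<forall>x\<in>U n. c x = 0 \<longrightarrow> card (U n) = k))"

lemma ex_greedy: "\<exists>c. is_greedy c"
proof -
  define col where "col A = (SOME f. inj_on f A \<and> f ` A \<subseteq> {..<k} \<and> (card A < k \<longrightarrow> 0 \<notin> f ` A))" for A :: "'a set"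
  have col: "inj_on (col A) A \<and> col A ` A \<subseteq> {..<k} \<and> (card A < k \<longrightarrow> 0 \<notin> col A ` A)"
    if "finite A" "card A \<le> k" for A
    unfolding col_def using someI_ex[OF avoiding_injection[OF that]] .
  have colC: "inj_on (col (C j)) (C j)" "col (C j) ` C j \<subseteq> {..<k}" "0 \<notin> col (C j) ` C j" for j
    using col[of "C j"] card_C[of j] by auto
  have colU: "inj_on (col (U n)) (U n)" "col (U n) ` U n \<subseteq> {..<k}" "card (U n) < k \<longrightarrow> 0 \<notin> col (U n) ` U n" for n
    using col[OF finite_U card_U] by auto
  define c where "c x = (if x \<in> K then 0 else if x \<in> F0 then col (C (top x)) x else col (U (THE n. x \<in> U n)) x)" for x
  have cK: "c x = 0" if "x \<in> K" for x using that by (simp add: c_def)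
  have cC: "c x = col (C j) x" if "x \<in> C j" for x j using that by (simp add: c_def C_def)
  have cU: "c x = col (U n) x" if "x \<in> U n" for x n
  proof -
    have "(THE n. x \<in> U n) = n" by (rule the_equality) (use that U_unique in blast)+
    moreover have "x \<notin> F0" using U_D(2)[OF that] F0_F by blast
    ultimately show ?thesis using K_F0 by (auto simp: c_def)
  qed
  have CC: "x \<in> C (top x)" if "x \<in> F0 - K" for x using that by (simp add: C_def)
  show ?thesis unfolding is_greedy_def
  proof (intro exI[of _ c] conjI ballI allI impI)
    fix x assume x: "x \<in> V"
    consider "x \<in> K" | "x \<in> F0 - K" | n where "x \<in> U n" using U_ex x by blast
    then show "c x < k"
    proof cases
      case 1 then show ?thesis using cK k2 by simp
    next
      case 2 then show ?thesis using cC[OF CC[OF 2]] colC(2)[of "top x"] CC[OF 2] by auto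
    next
      case (3 n) then show ?thesis using cU[OF 3] colU(2)[of n] by auto
    qed
  next
    fix x assume x: "x \<in> F0 - K"
    show "c x \<noteq> 0" using cC[OF CC[OF x]] colC(3)[of "top x"] CC[OF x] by auto
  next
    fix j show "inj_on c (C j)" using colC(1)[of j] cC[of _ j] by (simp cong: inj_on_cong)
  next
    fix n show "inj_on c (U n)" using colU(1)[of n] cU[of _ n] by (simp cong: inj_on_cong)
  next
    fix n x assume x: "x \<in> U n" "c x = 0"
    then have "0 \<in> col (U n) ` U n" using cU[OF x(1)] by force
    then show "card (U n) = k" using colU(3)[of n] card_U[of n] by linarith
  qed (rule cK)
qed

end

section \<open>The greedy colouring is distinguishing\<close>

locale greedy_colouring = slack_graph +
  fixes c :: "'a \<Rightarrow> nat"
  assumes greedy: "is_greedy c"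
begin

lemma c_lt: "x \<in> V \<Longrightarrow> c x < k"
  and c_K: "x \<in> K \<Longrightarrow> c x = 0"
  and c_F0: "x \<in> F0 \<Longrightarrow> c x = 0 \<Longrightarrow> x \<in> K"
  and c_C: "x \<in> C j \<Longrightarrow> y \<in> C j \<Longrightarrow> c x = c y \<Longrightarrow> x = y"
  and c_U: "x \<in> U n \<Longrightarrow> y \<in> U n \<Longrightarrow> c x = c y \<Longrightarrow> x = y"
  and c_U0: "x \<in> U n \<Longrightarrow> c x = 0 \<Longrightarrow> card (U n) = k"
  using greedy unfolding is_greedy_def inj_on_def by blast+

text \<open>The colour 0 of \<open>y\<close> shows that \<open>p n\<close> was full when chosen. An
  explored neighbour of \<open>y\<close> that is not full would then be a rival of
  \<open>p n\<close>, contrary to \<open>full_p\<close>.\<close>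

lemma zero_nb_full:
  assumes y: "y \<in> U n" "c y = 0" and x: "x \<in> F n" "E x y"
  shows "full (F n) x"
proof (rule ccontr)
  assume nf: "\<not> full (F n) x"
  have "full (F n) (p n)" using c_U0[OF y] by (simp add: full_def U_def)
  then have "\<not> rival (F n) (p n) x" by (rule full_p)
  moreover have "active (F n) x" using x U_D(2)[OF y(1)] by (auto simp: active_def)
  ultimately show False using nf x(2) y(1) by (auto simp: rival_def U_def)
qed

text \<open>If \<open>y\<close> came before \<open>z\<close>, then \<open>x\<close> is full when
  \<open>z\<close> is explored, so \<open>y\<close> must be the one explored neighbour of
  \<open>x\<close>, namely \<open>p l\<close>. But \<open>p l\<close> was explored before
  \<open>x\<close>, and \<open>y\<close> after it.\<close>

lemma zero_later_unique:
  assumes x: "x \<in> U l" and y: "y \<in> U m" "c y = 0" "E x y" and z: "z \<in> U n" "c z = 0" "E x z"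
    and lt: "l < m" "m \<le> n"
  shows "y = z"
proof (cases "m = n")
  case True
  then show ?thesis using c_U y z by simp
next
  case False
  have "full (F n) x" using zero_nb_full z x lt U_later by simp
  then have "y = p l"
    by (rule full_unique) (use y U_later[OF y(1)] x U_D(1,3)[OF x] E_sym F_mono[of l n] lt False in auto)
  then show ?thesis using U_D(3)[OF x] U_later[OF y(1), of l] lt by simp
qed

lemma zero_iray_private:
  assumes w: "iray w" and c0: "\<And>i. c (w i) = 0" and nK: "\<And>i. w i \<notin> K"
  shows "k \<le> card (private_nb w)"
proof -
  \<comment> \<open>A vertex of colour 0 has at most one neighbour of colour 0 that is explored later. So the
    exploration times \<open>b\<close> have no inner local minimum along the ray, and hence increase.\<close>
  have "\<exists>n. w i \<in> U n" for i using U_ex[OF iray_V[OF w]] c_F0 c0 nK by blast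
  then obtain b where b: "\<And>i. w i \<in> U (b i)" by metis
  have e: "E (w i) (w (Suc i))" "E (w (Suc i)) (w i)" for i using iray_edge[OF w] E_sym by auto
  have ne: "b i \<noteq> b (Suc i)" for i
  proof
    assume "b i = b (Suc i)"
    then have "w i = w (Suc i)" using c_U[OF b[of i], of "w (Suc i)"] b[of "Suc i"] c0 by simp
    then show False using iray_eq_iff[OF w] by simp
  qed
  have nomin: "\<not> (b (Suc i) < b i \<and> b (Suc i) < b (Suc (Suc i)))" for i
  proof
    assume lt: "b (Suc i) < b i \<and> b (Suc i) < b (Suc (Suc i))"
    have "w i = w (Suc (Suc i))"
    proof (cases "b i \<le> b (Suc (Suc i))")
      case True
      then show ?thesis using zero_later_unique[OF b[of "Suc i"] b[of i] c0 e(2) b[of "Suc (Suc i)"] c0 e(1)] lt by simp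
    next
      case False
      then show ?thesis using zero_later_unique[OF b[of "Suc i"] b[of "Suc (Suc i)"] c0 e(1) b[of i] c0 e(2)] lt by simp
    qed
    then show False using iray_eq_iff[OF w] by simp
  qed
  have up: "b i < b (Suc i)" for i
  proof (rule ccontr)
    assume "\<not> b i < b (Suc i)"
    then have d0: "b (Suc i) < b i" using ne[of i] by simp
    have d: "b (Suc j) < b j" if "i \<le> j" for j
      using that
    proof (induction rule: dec_induct)
      case (step n)
      then show ?case using nomin[of n] ne[of "Suc n"] by linarith
    qed (rule d0)
    have "b (i + n) + n \<le> b i" for n
    proof (induction n)
      case (Suc n)
      then show ?case using d[of "i + n"] by simp
    qed simp
    from this[of "Suc (b i)"] show False by simp
  qed
  have mono: "i < j \<Longrightarrow> b i < b j" for i j using up by (rule lift_Suc_mono_less)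
  have full: "full (F (b (Suc i))) (w i)" for i
    by (rule zero_nb_full[OF b c0 _ e(1)]) (use U_later[OF b] up in simp)
  \<comment> \<open>At time \<open>b (Suc (Suc i))\<close> the full vertex \<open>w (Suc i)\<close>
    has a single explored neighbour, and both sides qualify.\<close>
  have parent: "p (b (Suc i)) = w i" for i
  proof (rule full_unique[OF full[of "Suc i"]])
    note u = U_D[OF b[of "Suc i"]]
    show "E (w (Suc i)) (p (b (Suc i)))" using u(1) E_sym by blast
    show "p (b (Suc i)) \<in> F (b (Suc (Suc i)))" using u(3) F_mono up[of "Suc i"] less_imp_le by blast
    show "w i \<in> F (b (Suc (Suc i)))" using U_later[OF b] mono by simp
  qed (rule e)
  have "nb (w 0) - {w 1} \<subseteq> private_nb w"
  proof
    \<comment> \<open>Exploring \<open>w 0\<close> at time \<open>b 1\<close> reveals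
      \<open>z\<close>. A later \<open>w (Suc j)\<close> adjacent to \<open>z\<close> is full at
      time \<open>b (Suc (Suc j))\<close> with \<open>w j\<close> as its explored neighbour, so
      \<open>z = w j\<close>; adjacency to \<open>w 0\<close> then forces
      \<open>j = 1\<close>.\<close>
    fix z assume z: "z \<in> nb (w 0) - {w 1}"
    have "\<not> E (w (Suc j)) z" for j
    proof
      assume ez: "E (w (Suc j)) z"
      have "z \<in> F (Suc (b (Suc 0)))" using z parent[of 0] by (auto simp: p_def)
      then have "z \<in> F (b (Suc (Suc j)))"
        using F_mono[of "Suc (b (Suc 0))" "b (Suc (Suc j))"] mono[of "Suc 0" "Suc (Suc j)"] by auto
      moreover have "w j \<in> F (b (Suc (Suc j)))" using U_later[OF b] mono by simp
      ultimately have zj: "z = w j" by (rule full_unique[OF full ez e(2)])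
      then have "E (w 0) (w j)" using z by simp
      then have "j = 1" using w by (simp add: iray_def)
      then show False using z zj by simp
    qed
    then show "z \<in> private_nb w" using z by (simp add: private_nb_def)
  qed
  then have le: "card (nb (w 0) - {w 1}) \<le> card (private_nb w)" by (rule card_mono[OF finite_private])
  \<comment> \<open>Besides its \<open>k\<close> unexplored neighbours at time \<open>b 1\<close>,
    the vertex \<open>w 0\<close> has the explored neighbour \<open>p (b 0)\<close>, so its degree
    is at least \<open>k + 1\<close>.\<close>
  have "p (b 0) \<in> nb (w 0)" "p (b 0) \<in> F (b 1)"
    using U_D(1,3)[OF b[of 0]] E_sym F_mono[of "b 0" "b 1"] up[of 0] by auto
  then have "nb (w 0) - F (b 1) \<subset> nb (w 0)" by blast
  then have "card (nb (w 0) - F (b 1)) < card (nb (w 0))" by (intro psubset_card_mono) auto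
  then have "k \<le> card (nb (w 0)) - 1" using full[of 0] by (simp add: full_def)
  also have "\<dots> = card (nb (w 0) - {w 1})" using e(1)[of 0] by simp
  finally show ?thesis using le by simp
qed

lemma aut_K:
  assumes g: "automorphism V E \<gamma>" and gc: "\<And>x. x \<in> V \<Longrightarrow> c (\<gamma> x) = c x"
  shows "\<gamma> (v i) \<in> K"
proof -
  have ir: "iray (\<lambda>i. \<gamma> (v i))" by (rule aut_iray[OF g v])
  have c0: "c (\<gamma> (v i)) = 0" for i using gc[OF iray_V[OF v]] c_K by simp
  have "\<exists>j. \<gamma> (v j) \<in> K"
  proof (rule ccontr)
    assume "\<nexists>j. \<gamma> (v j) \<in> K"
    then have "k \<le> card (private_nb (\<lambda>i. \<gamma> (v i)))" using zero_iray_private[OF ir] c0 by blast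
    then show False using card_private_aut[OF g v] slack by simp
  qed
  then obtain j where j: "\<gamma> (v j) \<in> K" ..
  \<comment> \<open>A neighbour of the ray lies in \<open>F0\<close>, where colour 0 occurs only on
    the ray. So one image vertex in \<open>K\<close> pulls in the whole image.\<close>
  have nxt: "\<gamma> (v m) \<in> K" if "\<gamma> (v l) \<in> K" "E (v l) (v m)" for l m
    using K_nb[OF that(1), of "\<gamma> (v m)" 0] aut_edge[OF g iray_V[OF v] iray_V[OF v]] that(2) c_F0 c0 by simp
  have down: "\<gamma> (v (j - n)) \<in> K" for n
  proof (induction n)
    case (Suc n)
    show ?case
    proof (cases "j - n")
      case (Suc m)
      then have "j - Suc n = m" by simp
      then show ?thesis using nxt[OF Suc.IH, of m] Suc iray_edge[OF v, of m] E_sym by simp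
    qed (use Suc in simp)
  qed (use j in simp)
  show ?thesis
  proof (induction i)
    case 0
    show ?case using down[of j] by simp
  next
    case (Suc i)
    then show ?case using nxt iray_edge[OF v] by blast
  qed
qed

lemma aut_fix_K:
  assumes g: "automorphism V E \<gamma>" and gc: "\<And>x. x \<in> V \<Longrightarrow> c (\<gamma> x) = c x"
  shows "\<gamma> (v i) = v i"
proof -
  obtain \<delta> where d: "automorphism V E \<delta>" and dg: "\<And>x. x \<in> V \<Longrightarrow> \<delta> (\<gamma> x) = x" "\<And>x. x \<in> V \<Longrightarrow> \<gamma> (\<delta> x) = x"
    using aut_inv[OF g] by blast
  have dc: "c (\<delta> x) = c x" if "x \<in> V" for x using gc[OF aut_V[OF d that]] dg(2)[OF that] by simp
  note vV = iray_V[OF v]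
  have nbK: "y = v 1" if "E (v 0) y" "y \<in> K" for y
    using that v by (auto simp: K_def iray_def)
  have g0: "\<gamma> (v 0) = v 0"
  proof -
    obtain f where f: "\<gamma> (v 0) = v f" using aut_K[OF g gc, of 0] by (auto simp: K_def)
    show ?thesis
    proof (cases f)
      case (Suc m)
      \<comment> \<open>The inverse \<open>\<delta>\<close> preserves colours too and so maps
        \<open>K\<close> into itself. An inner vertex \<open>v f\<close> has two neighbours in
        \<open>K\<close>, and both would be sent to the only neighbour \<open>v 1\<close> of
        \<open>v 0\<close> in \<open>K\<close>.\<close>
      have *: "\<delta> (v j) = v 1" if "E (v f) (v j)" for j
      proof (rule nbK)
        show "E (v 0) (\<delta> (v j))" using aut_edge[OF d vV[of f] vV[of j]] that dg(1)[OF vV[of 0]] f by simp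
      qed (rule aut_K[OF d dc])
      have "\<delta> (v m) = \<delta> (v (Suc f))"
        using *[of m] *[of "Suc f"] iray_edge[OF v] E_sym Suc by simp
      then show ?thesis using aut_inj[OF d vV vV] iray_eq_iff[OF v] Suc by simp
    qed (simp add: f)
  qed
  show ?thesis
  proof (induction i rule: less_induct)
    case (less i)
    show ?case
    proof (cases i)
      case (Suc m)
      have gm: "\<gamma> (v m) = v m" using less Suc by simp
      obtain f where f: "\<gamma> (v i) = v f" using aut_K[OF g gc, of i] by (auto simp: K_def)
      have "E (v m) (v f)" using aut_edge[OF g vV[of m] vV[of i]] iray_edge[OF v, of m] Suc gm f by simp
      then have "f = Suc m \<or> m = Suc f" using v by (simp add: iray_def)
      then show ?thesis
      proof
        assume "m = Suc f"
        then have "\<gamma> (v f) = \<gamma> (v i)" using less Suc f by simp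
        then have "v f = v i" using aut_inj[OF g vV vV] by blast
        then show ?thesis using f by simp
      qed (use f Suc in simp)
    qed (use g0 in simp)
  qed
qed

lemma aut_fix:
  assumes g: "automorphism V E \<gamma>" and gc: "\<And>x. x \<in> V \<Longrightarrow> c (\<gamma> x) = c x" and x: "x \<in> V"
  shows "\<gamma> x = x"
proof -
  have gK: "\<gamma> y = y" if "y \<in> K" for y using aut_fix_K[OF g gc] that by (auto simp: K_def)
  have "\<forall>x\<in>F n. \<gamma> x = x" for n
  proof (induction n)
    case 0
    have "\<gamma> x = x" if x0: "x \<in> F0" for x
    proof (cases "x \<in> K")
      case False
      have xV: "x \<in> V" using x0 F_V[of 0] by auto
      have adj: "E (v j) (\<gamma> x) \<longleftrightarrow> E (v j) x" for j
        using aut_edge[OF g iray_V[OF v, of j] xV] gK[of "v j"] by simp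
      have "\<gamma> x \<notin> K"
      proof
        assume "\<gamma> x \<in> K"
        then have "\<gamma> (\<gamma> x) = \<gamma> x" by (rule gK)
        then have "\<gamma> x = x" using aut_inj[OF g aut_V[OF g xV] xV] by simp
        then show False using \<open>\<gamma> x \<in> K\<close> False by simp
      qed
      moreover have "\<gamma> x \<in> F0" using K_nb[of "v (top x)" "\<gamma> x" 0] top(1)[OF x0 False] adj by simp
      \<comment> \<open>As the ray is fixed pointwise, \<open>x\<close> and its image have the same
        neighbours on it, hence lie in one class \<open>C\<close>, where colours are
        distinct.\<close>
      moreover have "top (\<gamma> x) = top x" unfolding top_def adj ..
      ultimately have "\<gamma> x \<in> C (top x)" by (simp add: C_def)
      moreover have "x \<in> C (top x)" using x0 False by (simp add: C_def)
      ultimately show ?thesis by (rule c_C[OF _ _ gc[OF xV]])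
    qed (rule gK)
    then show ?case by simp
  next
    case (Suc n)
    have "\<gamma> x = x" if xU: "x \<in> U n" for x
    proof -
      note u = U_D[OF xU]
      have xV: "x \<in> V" using u(1) E_V2 by blast
      have "E (p n) (\<gamma> x)"
        using aut_edge[OF g E_V1[OF u(1)] xV] u(1) u(3) Suc by simp
      moreover have "\<gamma> x \<notin> F n"
      proof
        assume gx: "\<gamma> x \<in> F n"
        then have "\<gamma> (\<gamma> x) = \<gamma> x" using Suc by blast
        then have "\<gamma> x = x" using aut_inj[OF g aut_V[OF g xV] xV] by simp
        then show False using gx u(2) by simp
      qed
      ultimately have "\<gamma> x \<in> U n" by (simp add: U_def)
      then show ?thesis using xU gc[OF xV] by (rule c_U)
    qed
    then show ?case using Suc unfolding F_Suc by blast
  qed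
  then show ?thesis using x Union_F by blast
qed

lemma distinguishing: "distinguishing_colouring V E k c"
  unfolding distinguishing_colouring_def using c_lt aut_fix by blast

end

section \<open>The two cases combined\<close>

lemma (in bounded_graph) ex_distinguishing: "\<exists>c. distinguishing_colouring V E k c"
proof (cases "\<exists>v. iray v \<and> card (private_nb v) < k")
  case True
  then obtain v where "iray v" "card (private_nb v) < k" by blast
  then interpret slack_graph V E k v by unfold_locales
  obtain c where "is_greedy c" using ex_greedy by blast
  then interpret greedy_colouring V E k v c by unfold_locales
  show ?thesis using distinguishing by blast
next
  case False
  obtain R where "iray R" using ex_iray by blast
  then interpret all_private_graph V E k R by unfold_locales (use False in \<open>auto simp: not_less\<close>)
  show ?thesis by (rule ex_distinguishing_all_private)
qed

theorem theorem1p3: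
  fixes V :: "'a set" and E :: "'a \<Rightarrow> 'a \<Rightarrow> bool" and \<Delta> :: nat
  assumes "simple_graph V E"
    and "infinite V"
    and "connected_graph V E"
    and "max_degree V E \<Delta>"
    and "3 \<le> \<Delta>"
  shows "distinguishing_number V E \<le> \<Delta> - 1"
proof -
  interpret bounded_graph V E "\<Delta> - 1"
    using assms by unfold_locales (auto simp: max_degree_def degree_def)
  show ?thesis unfolding distinguishing_number_def by (rule Least_le) (rule ex_distinguishing)
qed

end
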